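(* Assume the helper's CPU is underutilized, i.e. $\ell<U_K$. Then the proportional CPU-utilization scheme is the optimal offloading policy when the buffer size $Q\to 0$ (asymptotic optimality).
   Context: Setting. A user offloads a total of $\ell>0$ bits to a helper that stores offloaded bits in a buffer of size $Q$ (bits) before computing them. The helper's CPU alternates between idle and busy states; state changes occur at times $0=s_0<s_1<\dots<s_K=T_{\rm end}$, and epoch $k$ is $[s_{k-1},s_k]$ of length $\tau_k=s_k-s_{k-1}$. The indicator $a_k\in\{0,1\}$ equals $1$ if the CPU is idle in epoch $k$ and $0$ if busy; consecutive epochs have different states and the last epoch $K$ is idle. The helper's CPU frequency is $f_h>0$, $C>0$ is the number of CPU cycles needed per bit, and $U_k=\sum_{j=1}^k a_j\tau_j f_h/C$ is the number of bits the helper can compute up to time $s_k$ (the CPU-idling profile). An offloading policy is a vector $\boldsymbol{\ell}=(\ell_1,\dots,\ell_K)\ge\boldsymbol 0$ ($\ell_k$ = bits offloaded in epoch $k$). The computed bits $d_k$ and buffer contents $B_k$ evolve by $B_0=0$, $d_k(\ell_k)=\min\{B_{k-1}+\ell_k,\ a_k\tau_kf_h/C\}$, $B_k=\sum_{j=1}^k\ell_j-\sum_{j=1}^kd_j(\ell_j)$. A policy is feasible with buffer size $Q$ if $\sum_{k=1}^Kd_k(\ell_k)=\sum_{k=1}^K\ell_k=\ell$ and $B_k\le Q$ for $k=1,\dots,K$. Its transmission energy is $\sum_{k=1}^K\frac{\tau_k}{h^2}g(\ell_k/\tau_k)$ with $g(x)=N_0(2^{x/W}-1)$ and constants $h,N_0,W>0$.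 An optimal offloading policy is a feasible policy of minimum transmission energy. Proportional CPU-utilization scheme (for a small buffer and $\ell<U_K$): in every idle epoch the helper assigns to the user a fixed number $\tilde f_h=f_h\,\ell/U_K$ of CPU cycles per second, without adjusting the CPU frequency, and the user fully utilizes the allocated CPU resource. The effective CPU-idling profile is thus $\tilde U_k=U_k\,\ell/U_K$, $k=1,\dots,K$ (so $\tilde U_K=\ell$), and the offloading policy of the scheme with buffer size $Q$ is the minimizer of the transmission energy over $\boldsymbol{\ell}\ge\boldsymbol 0$ subject to $\tilde U_k\le\sum_{j=1}^k\ell_j\le\min\{\tilde U_k+Q,\ell\}$ for $k=1,\dots,K-1$ and $\sum_{k=1}^K\ell_k=\ell$. *)

theory Defs
  imports Complex_Main "HOL-Library.FuncSet"
begin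

text \<open>
  Epochs are numbered from 1 to \<open>epochs M\<close>; epoch \<open>k\<close> is the interval from
  \<open>switch_time M (k - 1)\<close> to \<open>switch_time M k\<close>. The indicator \<open>a\<^sub>k\<close> is
  \<open>of_bool (idle M k)\<close>.
\<close>

record offload_system =
  epochs :: nat
  switch_time :: "nat \<Rightarrow> real"
  idle :: "nat \<Rightarrow> bool"
  cpu_freq :: real
  cycles_per_bit :: real
  chan_gain :: real
  noise :: real
  bandwidth :: real

definition valid_system :: "offload_system \<Rightarrow> bool" where
  "valid_system M \<longleftrightarrow>
     epochs M \<ge> 1 \<and>
     switch_time M 0 = 0 \<and>
     (\<forall>k\<in>{1..epochs M}. switch_time M (k - 1) < switch_time M k) \<and>
     (\<forall>k\<in>{1..<epochs M}. idle M (k + 1) \<longleftrightarrow> \<not> idle M k) \<and>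
     idle M (epochs M) \<and>
     cpu_freq M > 0 \<and> cycles_per_bit M > 0 \<and>
     chan_gain M > 0 \<and> noise M > 0 \<and> bandwidth M > 0"

definition epoch_len :: "offload_system \<Rightarrow> nat \<Rightarrow> real" where
  "epoch_len M k = switch_time M k - switch_time M (k - 1)"

definition epoch_capacity :: "offload_system \<Rightarrow> nat \<Rightarrow> real" where
  "epoch_capacity M k = of_bool (idle M k) * epoch_len M k * cpu_freq M / cycles_per_bit M"

definition idling_profile :: "offload_system \<Rightarrow> nat \<Rightarrow> real" where
  "idling_profile M k = (\<Sum>j=1..k. epoch_capacity M j)"

primrec buffer :: "offload_system \<Rightarrow> (nat \<Rightarrow> real) \<Rightarrow> nat \<Rightarrow> real" where
  "buffer M l 0 = 0"
| "buffer M l (Suc k) =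
     buffer M l k + l (Suc k) - min (buffer M l k + l (Suc k)) (epoch_capacity M (Suc k))"

definition computed_bits :: "offload_system \<Rightarrow> (nat \<Rightarrow> real) \<Rightarrow> nat \<Rightarrow> real" where
  "computed_bits M l k = min (buffer M l (k - 1) + l k) (epoch_capacity M k)"

lemma buffer_eq_sum_diff:
  "buffer M l k = (\<Sum>j=1..k. l j) - (\<Sum>j=1..k. computed_bits M l j)"
  by (induction k) (simp_all add: computed_bits_def)

text \<open>
  A policy is a vector indexed by the epochs. Taking it to be extensional makes functions that
  agree on all epochs equal, so that uniqueness of a policy is meaningful.
\<close>

definition policies :: "offload_system \<Rightarrow> (nat \<Rightarrow> real) set" where
  "policies M = {1..epochs M} \<rightarrow>\<^sub>E {0..}"

definition feasible_policies :: "offload_system \<Rightarrow> real \<Rightarrow> real \<Rightarrow> (nat \<Rightarrow> real) set" where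
  "feasible_policies M L Q =
     {l \<in> policies M.
        (\<Sum>k=1..epochs M. computed_bits M l k) = (\<Sum>k=1..epochs M. l k) \<and>
        (\<Sum>k=1..epochs M. l k) = L \<and>
        (\<forall>k\<in>{1..epochs M}. buffer M l k \<le> Q)}"

definition power_fun :: "offload_system \<Rightarrow> real \<Rightarrow> real" where
  "power_fun M x = noise M * (2 powr (x / bandwidth M) - 1)"

definition energy :: "offload_system \<Rightarrow> (nat \<Rightarrow> real) \<Rightarrow> real" where
  "energy M l =
     (\<Sum>k=1..epochs M. epoch_len M k / (chan_gain M)\<^sup>2 * power_fun M (l k / epoch_len M k))"

definition optimal_policy :: "offload_system \<Rightarrow> real \<Rightarrow> real \<Rightarrow> (nat \<Rightarrow> real) \<Rightarrow> bool" where
  "optimal_policy M L Q = is_arg_min (energy M) (\<lambda>l. l \<in> feasible_policies M L Q)"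

definition allocated_freq :: "offload_system \<Rightarrow> real \<Rightarrow> real" where
  "allocated_freq M L = cpu_freq M * L / idling_profile M (epochs M)"

definition effective_profile :: "offload_system \<Rightarrow> real \<Rightarrow> nat \<Rightarrow> real" where
  "effective_profile M L k = idling_profile M k * L / idling_profile M (epochs M)"

lemma effective_profile_eq:
  "effective_profile M L k = idling_profile (M\<lparr>cpu_freq := allocated_freq M L\<rparr>) k"
proof -
  have "epoch_capacity (M\<lparr>cpu_freq := allocated_freq M L\<rparr>) j =
          epoch_capacity M j * (L / idling_profile M (epochs M))" for j
    by (simp add: epoch_capacity_def epoch_len_def allocated_freq_def mult_ac)
  then show ?thesis
    unfolding effective_profile_def idling_profile_def by (simp add: sum_distrib_right sum_divide_distrib [of _ "{Suc 0..k}"])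
qed

definition proportional_constraints ::
    "offload_system \<Rightarrow> real \<Rightarrow> real \<Rightarrow> (nat \<Rightarrow> real) set" where
  "proportional_constraints M L Q =
     {l \<in> policies M.
        (\<forall>k\<in>{1..<epochs M}.
           effective_profile M L k \<le> (\<Sum>j=1..k. l j) \<and>
           (\<Sum>j=1..k. l j) \<le> min (effective_profile M L k + Q) L) \<and>
        (\<Sum>k=1..epochs M. l k) = L}"

definition proportional_policy ::
    "offload_system \<Rightarrow> real \<Rightarrow> real \<Rightarrow> (nat \<Rightarrow> real) \<Rightarrow> bool" where
  "proportional_policy M L Q = is_arg_min (energy M) (\<lambda>l. l \<in> proportional_constraints M L Q)"

end

theory Submission
  imports Defs "HOL-Analysis.Function_Topology"
begin

text \<open>
  With \<open>Q = 0\<close> nothing can be buffered, so bits are offloaded only in idle epochs, and strict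
  convexity of the power function makes the constant-rate allocation optimal. It respects the CPU
  capacities because \<open>L < U\<^sub>K\<close>, and it is the policy of the proportional scheme. For \<open>Q > 0\<close>
  this limit policy is still admissible both for the optimum and for the scheme, so both minimisers
  have at most its energy. The feasible sets are compact and shrink to the one for \<open>Q = 0\<close>, where
  no other policy has such low energy; hence both minimisers converge to the limit policy.
\<close>

section \<open>A convergence criterion in compact sets and convexity of exponentials\<close>

lemma tendsto_compact_unique_cluster:
  fixes p :: "'a :: topological_space"
  assumes "compact C" and C: "eventually (\<lambda>i. f i \<in> C) F"
    and sep: "\<And>z. z \<in> C \<Longrightarrow> z \<noteq> p \<Longrightarrow> \<exists>U. open U \<and> z \<in> U \<and> eventually (\<lambda>i. f i \<notin> U) F"
  shows "(f \<longlongrightarrow> p) F"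
proof (rule topological_tendstoI)
  fix V assume "open V" "p \<in> V"
  obtain U where U: "\<And>z. z \<in> C - V \<Longrightarrow> open (U z) \<and> z \<in> U z \<and> eventually (\<lambda>i. f i \<notin> U z) F"
    using sep \<open>p \<in> V\<close> by (metis DiffE)
  \<comment> \<open>Finitely many of the separating sets cover \<open>C - V\<close>. The values of
    \<open>f\<close> eventually avoid all of them while staying in \<open>C\<close>, so they lie in
    \<open>V\<close>.\<close>
  have "compact (C - V)"
    using \<open>compact C\<close> \<open>open V\<close> by (rule compact_diff)
  then obtain D where D: "D \<subseteq> C - V" "finite D" "C - V \<subseteq> (\<Union>z\<in>D. U z)"
    by (rule compactE_image[of "C - V" "C - V" U]) (use U in auto)
  have "eventually (\<lambda>i. \<forall>z\<in>D. f i \<notin> U z) F"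
    using D U by (intro eventually_ball_finite) auto
  with C show "eventually (\<lambda>i. f i \<in> V) F"
    by eventually_elim (use D in blast)
qed

text \<open>With \<open>u\<close> and \<open>v\<close> the square roots of the two powers, the power
  at the midpoint is \<open>u * v\<close>, and the gap to the average is the square
  \<open>(u - v)\<^sup>2 / 2\<close>.\<close>

lemma powr_midpoint_le:
  fixes x y b :: real
  assumes "b > 0"
  shows "b powr ((x + y) / 2) \<le> (b powr x + b powr y) / 2"
    and "b \<noteq> 1 \<Longrightarrow> x \<noteq> y \<Longrightarrow> b powr ((x + y) / 2) < (b powr x + b powr y) / 2"
proof -
  define u v where "u = b powr (x / 2)" and "v = b powr (y / 2)"
  have eqs: "b powr ((x + y) / 2) = u * v" "b powr x = u\<^sup>2" "b powr y = v\<^sup>2"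
    by (simp_all add: u_def v_def add_divide_distrib powr_add power2_eq_square flip: powr_add)
  have sq: "(u\<^sup>2 + v\<^sup>2) / 2 - u * v = (u - v)\<^sup>2 / 2"
    by (simp add: power2_eq_square field_simps)
  then show "b powr ((x + y) / 2) \<le> (b powr x + b powr y) / 2"
    unfolding eqs by (smt (verit) zero_le_power2 divide_nonneg_pos)
  assume "b \<noteq> 1" "x \<noteq> y"
  then have "u \<noteq> v"
    using assms powr_inj[of b "x / 2" "y / 2"] by (simp add: u_def v_def)
  then have "(u - v)\<^sup>2 / 2 > 0"
    by simp
  then show "b powr ((x + y) / 2) < (b powr x + b powr y) / 2"
    unfolding eqs using sq by linarith
qed

text \<open>This is \<open>1 + t \<le> exp t\<close> at \<open>t = (x - r) * ln b\<close>,
  multiplied by \<open>b powr r\<close>. It supplies the first-order optimality argument for the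
  limit policy.\<close>

lemma powr_ge_tangent:
  fixes x r b :: real
  assumes "b > 0"
  shows "b powr x \<ge> b powr r + b powr r * ln b * (x - r)"
proof -
  have "1 + (x - r) * ln b \<le> b powr (x - r)"
    using assms exp_ge_add_one_self[of "(x - r) * ln b"] by (simp add: powr_def)
  then have "b powr r * (1 + (x - r) * ln b) \<le> b powr r * b powr (x - r)"
    by (intro mult_left_mono) auto
  then show ?thesis
    by (simp add: algebra_simps flip: powr_add)
qed

section \<open>Continuity and midpoint convexity of the constraints\<close>

lemma continuous_on_coordinate:
  "continuous_on UNIV (\<lambda>l :: nat \<Rightarrow> real. l k)"
  by (rule continuous_on_product_coordinates)

lemma continuous_on_partial_sum:
  "continuous_on UNIV (\<lambda>l :: nat \<Rightarrow> real. \<Sum>j=1..k. l j)"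
  by (intro continuous_on_sum continuous_on_coordinate)

lemma continuous_on_buffer: "continuous_on UNIV (\<lambda>l. buffer M l k)"
  by (induction k) (auto intro!: continuous_intros continuous_on_coordinate)

lemma buffer_nonneg: "buffer M l k \<ge> 0"
  by (cases k) auto

text \<open>Everything offloaded gets computed exactly when the final buffer is empty. In this form
  every buffer condition is a sublevel or level set of a continuous function.\<close>

lemma feasible_policies_eq:
  "feasible_policies M L Q =
     {l \<in> policies M. buffer M l (epochs M) = 0 \<and> (\<Sum>k=1..epochs M. l k) = L \<and>
        (\<forall>k\<in>{1..epochs M}. buffer M l k \<le> Q)}"
  unfolding feasible_policies_def buffer_eq_sum_diff by auto

text \<open>The midpoint of two minimisers is the witness against non-uniqueness. Restricting to the
  epochs keeps it extensional.\<close>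

definition midpoint_policy ::
    "offload_system \<Rightarrow> (nat \<Rightarrow> real) \<Rightarrow> (nat \<Rightarrow> real) \<Rightarrow> nat \<Rightarrow> real" where
  "midpoint_policy M x y = (\<lambda>k\<in>{1..epochs M}. (x k + y k) / 2)"

lemma midpoint_policy_in_policies:
  "x \<in> policies M \<Longrightarrow> y \<in> policies M \<Longrightarrow> midpoint_policy M x y \<in> policies M"
  unfolding midpoint_policy_def policies_def
  by (rule restrict_PiE_iff[THEN iffD2]) (auto simp: PiE_iff)

lemma sum_midpoint_policy:
  assumes "k \<le> epochs M"
  shows "(\<Sum>j=1..k. midpoint_policy M x y j) = ((\<Sum>j=1..k. x j) + (\<Sum>j=1..k. y j)) / 2"
proof -
  have "(\<Sum>j=1..k. midpoint_policy M x y j) = (\<Sum>j=1..k. (x j + y j) / 2)"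
    using assms by (intro sum.cong) (auto simp: midpoint_policy_def)
  then show ?thesis
    by (simp add: sum.distrib flip: sum_divide_distrib)
qed

text \<open>The recursion reads \<open>max 0 (B + l - c)\<close>, which is convex and monotone in
  the previous buffer content, so convexity passes from one epoch to the next.\<close>

lemma buffer_midpoint_policy_le:
  "k \<le> epochs M \<Longrightarrow> buffer M (midpoint_policy M x y) k \<le> (buffer M x k + buffer M y k) / 2"
  by (induction k) (auto simp: midpoint_policy_def min_def field_simps)

lemma midpoint_policy_feasible:
  assumes "x \<in> feasible_policies M L Q" "y \<in> feasible_policies M L Q"
  shows "midpoint_policy M x y \<in> feasible_policies M L Q"
proof -
  have "buffer M (midpoint_policy M x y) (epochs M) = 0"
    using assms buffer_midpoint_policy_le[of "epochs M" M x y]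
      buffer_nonneg[of M "midpoint_policy M x y" "epochs M"]
    by (auto simp: feasible_policies_eq)
  moreover have "buffer M (midpoint_policy M x y) k \<le> Q" if "k \<in> {1..epochs M}" for k
  proof -
    have "buffer M x k \<le> Q" "buffer M y k \<le> Q"
      using assms that unfolding feasible_policies_eq by blast+
    with buffer_midpoint_policy_le[of k M x y] that show ?thesis
      by auto
  qed
  ultimately show ?thesis
    using assms unfolding feasible_policies_eq
    by (simp add: midpoint_policy_in_policies sum_midpoint_policy del: One_nat_def)
qed

lemma midpoint_policy_proportional:
  assumes "x \<in> proportional_constraints M L Q" "y \<in> proportional_constraints M L Q"
  shows "midpoint_policy M x y \<in> proportional_constraints M L Q"
proof -
  have "effective_profile M L k \<le> (\<Sum>j=1..k. midpoint_policy M x y j) \<and>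
        (\<Sum>j=1..k. midpoint_policy M x y j) \<le> min (effective_profile M L k + Q) L"
    if k: "k \<in> {1..<epochs M}" for k
  proof -
    have "effective_profile M L k \<le> (\<Sum>j=1..k. l j) \<and>
          (\<Sum>j=1..k. l j) \<le> min (effective_profile M L k + Q) L" if "l \<in> {x, y}" for l
      using assms k that unfolding proportional_constraints_def by blast
    from this[of x] this[of y] k show ?thesis
      by (simp add: sum_midpoint_policy field_simps del: One_nat_def)
  qed
  then show ?thesis
    using assms unfolding proportional_constraints_def
    by (simp add: midpoint_policy_in_policies sum_midpoint_policy del: One_nat_def)
qed

section \<open>Compactness of the constraint sets\<close>

lemma compact_policies_sum:
  "compact {l \<in> policies M. (\<Sum>k=1..epochs M. l k) = L}"
proof -
  \<comment> \<open>Nonnegative entries with sum \<open>L\<close> are at most \<open>L\<close>, and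
    coordinates outside the epochs are pinned to \<open>undefined\<close>. The policies thus lie in
    a product of compact sets, where Tychonoff applies.\<close>
  define S where "S k = (if k \<in> {1..epochs M} then {0..L} else {undefined})" for k
  have "compactin (product_topology (\<lambda>_. euclidean) UNIV) (PiE UNIV S)"
    unfolding compactin_PiE by (auto simp: S_def)
  then have "compact (PiE UNIV S)"
    by (simp add: euclidean_product_topology)
  then have *: "compact (PiE UNIV S \<inter> {l. (\<Sum>k=1..epochs M. l k) = L})"
    by (intro compact_Int_closed closed_Collect_eq continuous_on_partial_sum continuous_on_const)
  have "l k \<le> L" if "l \<in> policies M" "(\<Sum>k=1..epochs M. l k) = L" "k \<in> {1..epochs M}" for l k
    using that member_le_sum[of k "{1..epochs M}" l] by (auto simp: policies_def PiE_iff)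
  then have "{l \<in> policies M. (\<Sum>k=1..epochs M. l k) = L} =
          PiE UNIV S \<inter> {l. (\<Sum>k=1..epochs M. l k) = L}"
    by (auto simp: policies_def PiE_iff S_def extensional_def split: if_splits)
  with * show ?thesis
    by simp
qed

lemma compact_feasible_policies: "compact (feasible_policies M L Q)"
proof -
  have "feasible_policies M L Q = {l \<in> policies M. (\<Sum>k=1..epochs M. l k) = L} \<inter>
     ({l. buffer M l (epochs M) = 0} \<inter> (\<Inter>k\<in>{1..epochs M}. {l. buffer M l k \<le> Q}))"
    unfolding feasible_policies_eq by auto
  also have "compact \<dots>"
    by (intro compact_Int_closed compact_policies_sum closed_Int closed_INT ballI
        closed_Collect_eq closed_Collect_le continuous_on_buffer continuous_on_const)
  finally show ?thesis .
qed

lemma compact_proportional_constraints: "compact (proportional_constraints M L Q)"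
proof -
  have "proportional_constraints M L Q = {l \<in> policies M. (\<Sum>k=1..epochs M. l k) = L} \<inter>
     (\<Inter>k\<in>{1..<epochs M}. {l. effective_profile M L k \<le> (\<Sum>j=1..k. l j)} \<inter>
        {l. (\<Sum>j=1..k. l j) \<le> min (effective_profile M L k + Q) L})"
    unfolding proportional_constraints_def by auto
  also have "compact \<dots>"
    by (intro compact_Int_closed compact_policies_sum closed_Int closed_INT ballI
        closed_Collect_le continuous_on_partial_sum continuous_on_const)
  finally show ?thesis .
qed

section \<open>Strict convexity of the energy and uniqueness of minimisers\<close>

context
  fixes M :: offload_system
  assumes valid: "valid_system M"
begin

lemma epoch_len_pos: "k \<in> {1..epochs M} \<Longrightarrow> epoch_len M k > 0"
  using valid by (auto simp: valid_system_def epoch_len_def)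

lemma constants_pos: "cpu_freq M > 0" "cycles_per_bit M > 0" "chan_gain M > 0" "noise M > 0"
  "bandwidth M > 0" "epochs M \<ge> 1" "idle M (epochs M)"
  using valid by (auto simp: valid_system_def)

lemma epoch_capacity_nonneg: "k \<in> {1..epochs M} \<Longrightarrow> epoch_capacity M k \<ge> 0"
  using epoch_len_pos[of k] constants_pos by (simp add: epoch_capacity_def)

lemma continuous_on_energy: "continuous_on UNIV (energy M)"
proof -
  have eq: "energy M = (\<lambda>l. \<Sum>k=1..epochs M. epoch_len M k / (chan_gain M)\<^sup>2 *
          (noise M * (2 powr (l k / epoch_len M k / bandwidth M) - 1)))"
    by (simp add: energy_def power_fun_def fun_eq_iff)
  show ?thesis
    unfolding eq
  proof (rule continuous_on_sum)
    fix k assume "k \<in> {1..epochs M}"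
    then show "continuous_on UNIV (\<lambda>l. epoch_len M k / (chan_gain M)\<^sup>2 *
          (noise M * (2 powr (l k / epoch_len M k / bandwidth M) - 1)))"
      using epoch_len_pos[of k] constants_pos
      by (intro continuous_on_mult continuous_on_diff continuous_on_powr continuous_on_divide
          continuous_on_coordinate continuous_on_const) auto
  qed
qed

lemma energy_midpoint_policy_less:
  assumes "x \<in> policies M" "y \<in> policies M" "x \<noteq> y"
  shows "energy M (midpoint_policy M x y) < (energy M x + energy M y) / 2"
proof -
  define t where "t l k = epoch_len M k / (chan_gain M)\<^sup>2 * power_fun M (l k / epoch_len M k)"
    for l :: "nat \<Rightarrow> real" and k
  \<comment> \<open>With weights \<open>c\<close> and scales \<open>w\<close>, each energy term
    becomes \<open>c k * (2 powr (l k / w k) - 1)\<close>, so convexity reduces to that of powers of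
    2.\<close>
  define c where "c k = epoch_len M k / (chan_gain M)\<^sup>2 * noise M" for k
  define w where "w k = epoch_len M k * bandwidth M" for k
  have cw: "c k > 0" "w k > 0" if "k \<in> {1..epochs M}" for k
    using epoch_len_pos[OF that] constants_pos by (auto simp: c_def w_def)
  have t: "t l k = c k * (2 powr (l k / w k) - 1)" for l k
    by (simp add: t_def c_def w_def power_fun_def)
  have mid: "t (midpoint_policy M x y) k = c k * (2 powr ((x k / w k + y k / w k) / 2) - 1)"
    if "k \<in> {1..epochs M}" for k
  proof -
    have "(x k + y k) / 2 / w k = (x k / w k + y k / w k) / 2"
      by (simp add: add_divide_distrib)
    moreover have "midpoint_policy M x y k = (x k + y k) / 2"
      using that by (simp add: midpoint_policy_def)
    ultimately show ?thesis
      by (simp only: t)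
  qed
  have avg: "(t x k + t y k) / 2 = c k * ((2 powr (x k / w k) + 2 powr (y k / w k)) / 2 - 1)" for k
    by (simp add: t field_simps)
  \<comment> \<open>Policies agree outside the epochs by extensionality, so distinct ones differ at
    some epoch; the strict inequality comes from there.\<close>
  have "\<exists>k\<in>{1..epochs M}. x k \<noteq> y k"
    using assms by (metis PiE_ext policies_def)
  then obtain i where i: "i \<in> {1..epochs M}" "x i \<noteq> y i"
    by blast
  have "(\<Sum>k=1..epochs M. t (midpoint_policy M x y) k) < (\<Sum>k=1..epochs M. (t x k + t y k) / 2)"
  proof (rule sum_strict_mono_ex1)
    show "\<forall>k\<in>{1..epochs M}. t (midpoint_policy M x y) k \<le> (t x k + t y k) / 2"
    proof
      fix k assume k: "k \<in> {1..epochs M}"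
      show "t (midpoint_policy M x y) k \<le> (t x k + t y k) / 2"
        unfolding mid[OF k] avg using cw[OF k] powr_midpoint_le(1)[of 2 "x k / w k" "y k / w k"]
        by (intro mult_left_mono) auto
    qed
    have "t (midpoint_policy M x y) i < (t x i + t y i) / 2"
      unfolding mid[OF i(1)] avg
      using cw[OF i(1)] i(2) powr_midpoint_le(2)[of 2 "x i / w i" "y i / w i"]
      by (intro mult_strict_left_mono) auto
    then show "\<exists>k\<in>{1..epochs M}. t (midpoint_policy M x y) k < (t x k + t y k) / 2"
      using i(1) by blast
  qed simp
  then show ?thesis
    by (simp add: energy_def t_def sum.distrib flip: sum_divide_distrib)
qed

text \<open>A continuous function attains its minimum on a compact set, and the midpoint of two
  distinct minimisers would have strictly smaller energy.\<close>

lemma ex1_is_arg_min_energy: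
  assumes "compact S" "S \<noteq> {}" "S \<subseteq> policies M"
    and mid: "\<And>x y. x \<in> S \<Longrightarrow> y \<in> S \<Longrightarrow> midpoint_policy M x y \<in> S"
  shows "\<exists>!x. is_arg_min (energy M) (\<lambda>l. l \<in> S) x"
proof -
  obtain x where x: "x \<in> S" "\<And>y. y \<in> S \<Longrightarrow> energy M x \<le> energy M y"
    using continuous_attains_inf[OF assms(1,2), of "energy M"] continuous_on_energy
    by (metis continuous_on_subset subset_UNIV)
  have "y = x" if "is_arg_min (energy M) (\<lambda>l. l \<in> S) y" for y
  proof (rule ccontr)
    assume "y \<noteq> x"
    have y: "y \<in> S" "energy M y \<le> energy M x"
      using that x(1) by (auto simp: is_arg_min_linorder)
    then have "energy M (midpoint_policy M x y) < (energy M x + energy M y) / 2"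
      using assms(3) x(1) \<open>y \<noteq> x\<close> by (intro energy_midpoint_policy_less) auto
    also have "\<dots> \<le> energy M x"
      using y(2) by simp
    finally show False
      using x(2)[OF mid[OF x(1) y(1)]] by simp
  qed
  moreover have "is_arg_min (energy M) (\<lambda>l. l \<in> S) x"
    using x by (simp add: is_arg_min_linorder)
  ultimately show ?thesis
    by blast
qed

end

section \<open>The limit policy: optimality at zero buffer size and convergence to it\<close>

context
  fixes M :: offload_system and L :: real
  assumes valid: "valid_system M" and L_pos: "L > 0"
    and underutilized: "L < idling_profile M (epochs M)"
begin

text \<open>These are the increments of \<open>effective_profile\<close>: all idle epochs share one
  rate, busy epochs get 0, and the lower bound of the scheme is met with equality.\<close>

definition limit_policy :: "nat \<Rightarrow> real" where
  "limit_policy = (\<lambda>k\<in>{1..epochs M}. epoch_capacity M k * L / idling_profile M (epochs M))"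

lemma profile_pos: "idling_profile M (epochs M) > 0"
  using L_pos underutilized by linarith

text \<open>The scaling factor \<open>L / idling_profile M (epochs M)\<close> lies between 0 and 1;
  the upper bound is where underutilization enters.\<close>

lemma scaled_capacity_le:
  assumes "k \<in> {1..epochs M}"
  shows "0 \<le> epoch_capacity M k * L / idling_profile M (epochs M)"
    and "epoch_capacity M k * L / idling_profile M (epochs M) \<le> epoch_capacity M k"
proof -
  show "0 \<le> epoch_capacity M k * L / idling_profile M (epochs M)"
    using epoch_capacity_nonneg[OF valid assms] profile_pos L_pos by simp
  have "epoch_capacity M k * L \<le> epoch_capacity M k * idling_profile M (epochs M)"
    using epoch_capacity_nonneg[OF valid assms] underutilized by (intro mult_left_mono) auto
  then show "epoch_capacity M k * L / idling_profile M (epochs M) \<le> epoch_capacity M k"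
    using profile_pos by (simp add: divide_le_eq)
qed

lemma effective_profile_Suc:
  "effective_profile M L (Suc k) =
     effective_profile M L k + epoch_capacity M (Suc k) * L / idling_profile M (epochs M)"
  by (simp add: effective_profile_def idling_profile_def add_divide_distrib distrib_right)

lemma effective_profile_epochs: "effective_profile M L (epochs M) = L"
  using profile_pos by (simp add: effective_profile_def)

lemma effective_profile_le:
  assumes "k \<le> epochs M"
  shows "effective_profile M L k \<le> L"
proof -
  have "effective_profile M L k \<le> effective_profile M L (epochs M)"
    using assms
  proof (induction rule: inc_induct)
    case (step n)
    then show ?case
      using scaled_capacity_le(1)[of "Suc n"] by (simp add: effective_profile_Suc)
  qed simp
  then show ?thesis
    by (simp add: effective_profile_epochs)
qed

lemma sum_limit_policy:
  assumes "k \<le> epochs M"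
  shows "(\<Sum>j=1..k. limit_policy j) = effective_profile M L k"
proof -
  have "(\<Sum>j=1..k. limit_policy j) =
      (\<Sum>j=1..k. epoch_capacity M j * L / idling_profile M (epochs M))"
    using assms by (intro sum.cong) (auto simp: limit_policy_def)
  then show ?thesis
    by (simp add: effective_profile_def idling_profile_def sum_distrib_right
        flip: sum_divide_distrib)
qed

lemma limit_policy_in_policies: "limit_policy \<in> policies M"
  unfolding policies_def limit_policy_def
  using scaled_capacity_le(1) by (auto simp: restrict_PiE_iff)

lemma limit_policy_proportional:
  assumes "Q \<ge> 0"
  shows "limit_policy \<in> proportional_constraints M L Q"
  unfolding proportional_constraints_def
  using assms limit_policy_in_policies effective_profile_le
  by (simp add: sum_limit_policy effective_profile_epochs del: One_nat_def)

text \<open>The buffer never exceeds the excess of the offloaded bits over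
  \<open>effective_profile\<close>: the true capacity dominates the scaled one, and the scheme's
  lower bound keeps the excess nonnegative. The excess is at most \<open>Q\<close> and vanishes at
  the end.\<close>

lemma proportional_subset_feasible:
  assumes "Q \<ge> 0"
  shows "proportional_constraints M L Q \<subseteq> feasible_policies M L Q"
proof
  fix l assume l: "l \<in> proportional_constraints M L Q"
  have total: "(\<Sum>j=1..epochs M. l j) = L"
    using l by (simp add: proportional_constraints_def)
  \<comment> \<open>The constraints cover only \<open>k < epochs M\<close>; at the last epoch both
    sums equal \<open>L\<close>.\<close>
  have bounds: "effective_profile M L k \<le> (\<Sum>j=1..k. l j) \<and>
      (\<Sum>j=1..k. l j) \<le> effective_profile M L k + Q" if "k \<in> {1..epochs M}" for k
  proof (cases "k = epochs M")
    case True
    with assms total effective_profile_epochs show ?thesis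
      by simp
  next
    case False
    with that have "k \<in> {1..<epochs M}"
      by simp
    with l have "effective_profile M L k \<le> (\<Sum>j=1..k. l j) \<and>
        (\<Sum>j=1..k. l j) \<le> min (effective_profile M L k + Q) L"
      unfolding proportional_constraints_def by blast
    then show ?thesis
      by simp
  qed
  have buffer: "buffer M l k \<le> (\<Sum>j=1..k. l j) - effective_profile M L k" if "k \<le> epochs M" for k
    using that
  proof (induction k)
    case 0
    show ?case
      by (simp add: effective_profile_def idling_profile_def)
  next
    case (Suc k)
    then show ?case
      using bounds[of "Suc k"] scaled_capacity_le(2)[of "Suc k"]
      by (auto simp: effective_profile_Suc min_def)
  qed
  have "buffer M l (epochs M) = 0"
    using buffer[of "epochs M"] buffer_nonneg[of M l "epochs M"] total effective_profile_epochs
    by simp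
  moreover have "buffer M l k \<le> Q" if "k \<in> {1..epochs M}" for k
    using buffer[of k] bounds[OF that] that by simp
  ultimately show "l \<in> feasible_policies M L Q"
    using l by (simp add: feasible_policies_eq proportional_constraints_def)
qed

lemma limit_policy_feasible: "Q \<ge> 0 \<Longrightarrow> limit_policy \<in> feasible_policies M L Q"
  using limit_policy_proportional proportional_subset_feasible by blast

lemma ex1_optimal_policy:
  assumes "Q \<ge> 0"
  shows "\<exists>!x. optimal_policy M L Q x"
  unfolding optimal_policy_def
proof (rule ex1_is_arg_min_energy[OF valid])
  show "feasible_policies M L Q \<noteq> {}"
    using limit_policy_feasible[OF assms] by blast
  show "feasible_policies M L Q \<subseteq> policies M"
    by (auto simp: feasible_policies_def)
qed (fact compact_feasible_policies midpoint_policy_feasible)+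

lemma ex1_proportional_policy:
  assumes "Q \<ge> 0"
  shows "\<exists>!x. proportional_policy M L Q x"
  unfolding proportional_policy_def
proof (rule ex1_is_arg_min_energy[OF valid])
  show "proportional_constraints M L Q \<noteq> {}"
    using limit_policy_proportional[OF assms] by blast
  show "proportional_constraints M L Q \<subseteq> policies M"
    by (auto simp: proportional_constraints_def)
qed (fact compact_proportional_constraints midpoint_policy_proportional)+

text \<open>Each energy term is bounded below by its tangent at the limit policy. The slope is the
  same in all idle epochs because the rate is, and busy epochs carry no bits in either policy. Since
  both totals are \<open>L\<close>, the linear terms cancel.\<close>

lemma energy_limit_policy_le:
  assumes l: "l \<in> feasible_policies M L 0"
  shows "energy M limit_policy \<le> energy M l"
proof -
  \<comment> \<open>\<open>r\<close> is the common rate of the limit policy in idle epochs, and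
    \<open>s\<close> below is the marginal energy per bit at that rate, that is, the Lagrange
    multiplier of the total.\<close>
  define r where "r = cpu_freq M / cycles_per_bit M * L / idling_profile M (epochs M)"
  define W where "W = bandwidth M"
  define c where "c = noise M / (chan_gain M)\<^sup>2"
  define s where "s = c * (2 powr (r / W)) * ln 2 / W"
  have pos: "c > 0" "W > 0"
    using constants_pos[OF valid] by (simp_all add: c_def W_def)
  have "epoch_len M k / (chan_gain M)\<^sup>2 * power_fun M (limit_policy k / epoch_len M k)
        + s * (l k - limit_policy k)
      \<le> epoch_len M k / (chan_gain M)\<^sup>2 * power_fun M (l k / epoch_len M k)"
    if k: "k \<in> {1..epochs M}" for k
  proof (cases "idle M k")
    case True
    define \<tau> where "\<tau> = epoch_len M k"
    have "\<tau> > 0"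
      using epoch_len_pos[OF valid k] by (simp add: \<tau>_def)
    have p: "limit_policy k = \<tau> * r"
      using k True by (simp add: limit_policy_def epoch_capacity_def \<tau>_def r_def)
    define x where "x = l k / \<tau>"
    have lk: "l k = \<tau> * x"
      using \<open>\<tau> > 0\<close> by (simp add: x_def)
    have "\<tau> * c * (2 powr (r / W) + 2 powr (r / W) * ln 2 * (x / W - r / W)) \<le> \<tau> * c * 2 powr (x / W)"
      using pos \<open>\<tau> > 0\<close> by (intro mult_left_mono powr_ge_tangent) auto
    moreover have "\<tau> * c * (2 powr (r / W) + 2 powr (r / W) * ln 2 * (x / W - r / W)) =
        \<tau> * c * 2 powr (r / W) + s * (\<tau> * x - \<tau> * r)"
      by (simp add: s_def algebra_simps diff_divide_distrib)
    ultimately have "\<tau> * c * (2 powr (r / W) - 1) + s * (\<tau> * x - \<tau> * r) \<le> \<tau> * c * (2 powr (x / W) - 1)"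
      by (simp add: algebra_simps)
    then show ?thesis
      unfolding p lk \<tau>_def[symmetric] using \<open>\<tau> > 0\<close>
      by (simp add: power_fun_def c_def W_def mult_ac)
  next
    case False
    from k obtain m where m: "k = Suc m"
      by (cases k) auto
    \<comment> \<open>In a busy epoch nothing is computed, so any bit offloaded there would remain
      in the buffer.\<close>
    have "buffer M l k \<le> 0"
      using l k unfolding feasible_policies_eq by blast
    then have "l k \<le> 0"
      using False buffer_nonneg[of M l m] by (simp add: m epoch_capacity_def min_def split: if_splits)
    moreover have "l k \<ge> 0"
      using l k unfolding feasible_policies_eq policies_def by (auto simp: PiE_iff)
    ultimately have "l k = limit_policy k"
      using False k by (simp add: limit_policy_def epoch_capacity_def)
    then show ?thesis
      by simp
  qed
  then have "(\<Sum>k=1..epochs M. epoch_len M k / (chan_gain M)\<^sup>2 *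
        power_fun M (limit_policy k / epoch_len M k) + s * (l k - limit_policy k)) \<le> energy M l"
    unfolding energy_def by (rule sum_mono)
  moreover have "(\<Sum>k=1..epochs M. s * (l k - limit_policy k)) = 0"
    using l sum_limit_policy[of "epochs M"]
    by (simp add: feasible_policies_def effective_profile_epochs sum_subtractf
        flip: sum_distrib_left)
  ultimately show ?thesis
    by (simp add: energy_def sum.distrib)
qed

lemma optimal_limit_policy: "optimal_policy M L 0 limit_policy"
  using limit_policy_feasible energy_limit_policy_le
  by (auto simp: optimal_policy_def is_arg_min_linorder)

text \<open>The scheme minimises over a subset of the feasible policies, and this subset contains
  the minimiser over all of them.\<close>

lemma proportional_limit_policy: "proportional_policy M L 0 limit_policy"
  using limit_policy_proportional energy_limit_policy_le proportional_subset_feasible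
  by (auto simp: proportional_policy_def is_arg_min_linorder)

text \<open>The last epoch is idle and so carries a positive number of bits. Positivity makes the
  limit of the energy ratio well defined.\<close>

lemma energy_limit_policy_pos: "energy M limit_policy > 0"
proof -
  have nonneg: "epoch_len M k / (chan_gain M)\<^sup>2 * power_fun M (limit_policy k / epoch_len M k) \<ge> 0"
    if k: "k \<in> {1..epochs M}" for k
  proof -
    have "limit_policy k \<ge> 0"
      using scaled_capacity_le(1)[OF k] k by (simp add: limit_policy_def)
    then have "limit_policy k / epoch_len M k / bandwidth M \<ge> 0"
      using epoch_len_pos[OF valid k] constants_pos[OF valid] by (intro divide_nonneg_pos) auto
    then show ?thesis
      using epoch_len_pos[OF valid k] constants_pos[OF valid]
      by (simp add: power_fun_def ge_one_powr_ge_zero)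
  qed
  let ?K = "epochs M"
  have K: "?K \<in> {1..?K}"
    using constants_pos[OF valid] by simp
  have "limit_policy ?K > 0"
    using K epoch_len_pos[OF valid K] constants_pos[OF valid] L_pos profile_pos
    by (simp add: limit_policy_def epoch_capacity_def)
  then have "epoch_len M ?K / (chan_gain M)\<^sup>2 * power_fun M (limit_policy ?K / epoch_len M ?K) > 0"
    using epoch_len_pos[OF valid K] constants_pos[OF valid]
    by (simp add: power_fun_def)
  then show ?thesis
    unfolding energy_def using K nonneg by (intro sum_pos2[of _ ?K]) auto
qed

text \<open>Stated for any feasible family with energy at most that of the limit policy, so that it
  serves the optimal and the proportional policies alike.\<close>

lemma tendsto_limit_policy:
  assumes x: "\<And>Q. Q > 0 \<Longrightarrow> x Q \<in> feasible_policies M L Q"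
    "\<And>Q. Q > 0 \<Longrightarrow> energy M (x Q) \<le> energy M limit_policy"
  shows "(x \<longlongrightarrow> limit_policy) (at_right 0)"
proof (rule tendsto_compact_unique_cluster)
  show "compact (feasible_policies M L 1)"
    by (rule compact_feasible_policies)
  have small: "eventually (\<lambda>Q. 0 < Q \<and> Q < e) (at_right 0)" if "e > 0" for e :: real
    using eventually_at_right_real[OF that] by eventually_elim auto
  \<comment> \<open>Feasible sets grow with \<open>Q\<close>, so the one for buffer size 1 contains
    \<open>x Q\<close> for all \<open>Q < 1\<close>.\<close>
  show "eventually (\<lambda>Q. x Q \<in> feasible_policies M L 1) (at_right 0)"
    using small[of 1, OF zero_less_one]
    by eventually_elim (use x(1) in \<open>fastforce simp: feasible_policies_def\<close>)
  fix z assume z: "z \<in> feasible_policies M L 1" "z \<noteq> limit_policy"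
  show "\<exists>U. open U \<and> z \<in> U \<and> eventually (\<lambda>Q. x Q \<notin> U) (at_right 0)"
  \<comment> \<open>A rival cluster point either costs too much, which the energy bound on
    \<open>x\<close> excludes near it, or it violates the zero-buffer constraint.\<close>
  proof (cases "energy M z > energy M limit_policy")
    case True
    have "eventually (\<lambda>Q. x Q \<notin> {l. energy M limit_policy < energy M l}) (at_right 0)"
      using small[of 1, OF zero_less_one] by eventually_elim (use x(2) in \<open>auto simp: not_less\<close>)
    moreover have "open {l. energy M limit_policy < energy M l}"
      by (intro open_Collect_less continuous_on_const continuous_on_energy[OF valid])
    ultimately show ?thesis
      using True by blast
  next
    case False
    \<comment> \<open>Otherwise \<open>z\<close> would be a second minimiser for zero buffer
      size.\<close>
    have "z \<notin> feasible_policies M L 0"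
    proof
      assume "z \<in> feasible_policies M L 0"
      with False have "optimal_policy M L 0 z"
        using energy_limit_policy_le by (force simp: optimal_policy_def is_arg_min_linorder)
      with z(2) optimal_limit_policy ex1_optimal_policy[of 0] show False
        by auto
    qed
    with z(1) obtain k where k: "k \<in> {1..epochs M}" "buffer M z k > 0"
      unfolding feasible_policies_eq by force
    \<comment> \<open>Half the buffer level at \<open>z\<close> leaves room for an open
      neighbourhood, which \<open>x Q\<close> cannot meet once \<open>Q < e\<close>.\<close>
    define e where "e = buffer M z k / 2"
    have "e > 0" "z \<in> {l. e < buffer M l k}"
      using k by (auto simp: e_def)
    moreover have "open {l. e < buffer M l k}"
      by (intro open_Collect_less continuous_on_const continuous_on_buffer)
    moreover have "eventually (\<lambda>Q. x Q \<notin> {l. e < buffer M l k}) (at_right 0)"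
      using small[OF \<open>e > 0\<close>]
      by eventually_elim (use x(1) k in \<open>force simp: feasible_policies_def\<close>)
    ultimately show ?thesis
      by blast
  qed
qed

end

section \<open>Asymptotic optimality of the proportional scheme\<close>

theorem proposition3:
  fixes M :: offload_system and L :: real
  assumes "valid_system M" and "L > 0"
    and "L < idling_profile M (epochs M)"
  shows "(\<forall>Q\<ge>0. (\<exists>!x. optimal_policy M L Q x) \<and> (\<exists>!y. proportional_policy M L Q y) \<and>
              (\<forall>y. proportional_policy M L Q y \<longrightarrow> y \<in> feasible_policies M L Q)) \<and>
         (\<forall>y. proportional_policy M L 0 y \<longleftrightarrow> optimal_policy M L 0 y) \<and>
         (\<forall>(x :: real \<Rightarrow> nat \<Rightarrow> real) (y :: real \<Rightarrow> nat \<Rightarrow> real).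
              (\<forall>Q>0. optimal_policy M L Q (x Q) \<and> proportional_policy M L Q (y Q)) \<longrightarrow>
              ((\<lambda>Q. energy M (y Q) - energy M (x Q)) \<longlongrightarrow> 0) (at_right 0) \<and>
              ((\<lambda>Q. energy M (y Q) / energy M (x Q)) \<longlongrightarrow> 1) (at_right 0) \<and>
              (\<forall>k\<in>{1..epochs M}. ((\<lambda>Q. y Q k - x Q k) \<longlongrightarrow> 0) (at_right 0)))"
proof (intro conjI allI impI)
  fix Q :: real assume Q: "Q \<ge> 0"
  show "\<exists>!x. optimal_policy M L Q x" "\<exists>!y. proportional_policy M L Q y"
    using ex1_optimal_policy[OF assms Q] ex1_proportional_policy[OF assms Q] by auto
  show "y \<in> feasible_policies M L Q" if "proportional_policy M L Q y" for y
    using that proportional_subset_feasible[OF assms Q]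
    by (auto simp: proportional_policy_def is_arg_min_linorder)
next
  \<comment> \<open>Both problems have \<open>limit_policy\<close> as their unique minimiser at zero
    buffer size.\<close>
  show "proportional_policy M L 0 y \<longleftrightarrow> optimal_policy M L 0 y" for y
    using optimal_limit_policy[OF assms] proportional_limit_policy[OF assms]
      ex1_optimal_policy[OF assms, of 0] ex1_proportional_policy[OF assms, of 0] by auto
next
  fix x y :: "real \<Rightarrow> nat \<Rightarrow> real"
  assume xy: "\<forall>Q>0. optimal_policy M L Q (x Q) \<and> proportional_policy M L Q (y Q)"
  let ?p = "limit_policy M L"
  have x: "(x \<longlongrightarrow> ?p) (at_right 0)"
    using xy limit_policy_feasible[OF assms]
    by (intro tendsto_limit_policy[OF assms]) (auto simp: optimal_policy_def is_arg_min_linorder)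
  have y: "(y \<longlongrightarrow> ?p) (at_right 0)"
  proof (rule tendsto_limit_policy[OF assms])
    fix Q :: real assume "Q > 0"
    with xy have "y Q \<in> proportional_constraints M L Q"
      "\<And>l. l \<in> proportional_constraints M L Q \<Longrightarrow> energy M (y Q) \<le> energy M l"
      by (auto simp: proportional_policy_def is_arg_min_linorder)
    \<comment> \<open>The limit policy satisfies the scheme's own constraints for every
      \<open>Q\<close>, so it competes with \<open>y Q\<close> directly.\<close>
    with \<open>Q > 0\<close> show "y Q \<in> feasible_policies M L Q" "energy M (y Q) \<le> energy M ?p"
      using proportional_subset_feasible[OF assms, of Q] limit_policy_proportional[OF assms, of Q]
      by auto
  qed
  \<comment> \<open>Continuity of the energy in the product topology gives both energies the same
    limit, which settles the difference and, being positive, also the ratio.\<close>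
  have energy_tendsto: "((\<lambda>Q. energy M (z Q)) \<longlongrightarrow> energy M ?p) (at_right 0)"
    if "(z \<longlongrightarrow> ?p) (at_right 0)" for z
    using continuous_on_tendsto_compose[OF continuous_on_energy[OF assms(1)] that] by simp
  note ex = energy_tendsto[OF x] and ey = energy_tendsto[OF y]
  show "((\<lambda>Q. energy M (y Q) - energy M (x Q)) \<longlongrightarrow> 0) (at_right 0)"
    using tendsto_diff[OF ey ex] by simp
  show "((\<lambda>Q. energy M (y Q) / energy M (x Q)) \<longlongrightarrow> 1) (at_right 0)"
    using tendsto_divide[OF ey ex] energy_limit_policy_pos[OF assms] by simp
  show "\<forall>k\<in>{1..epochs M}. ((\<lambda>Q. y Q k - x Q k) \<longlongrightarrow> 0) (at_right 0)"
  proof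
    fix k
    have "((\<lambda>Q. y Q k - x Q k) \<longlongrightarrow> ?p k - ?p k) (at_right 0)"
      using continuous_on_tendsto_compose[OF continuous_on_coordinate x, of k]
        continuous_on_tendsto_compose[OF continuous_on_coordinate y, of k]
      by (intro tendsto_diff) simp_all
    then show "((\<lambda>Q. y Q k - x Q k) \<longlongrightarrow> 0) (at_right 0)"
      by simp
  qed
qed

end
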